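(* Let $n$ be a positive integer, let $t$ be an integer, and let $b=\lfloor\log_2 n\rfloor+2$. Then evaluating the expansion of $(t+1+x_1)^n\in\mathcal{K}'_b$ at $x_1=x_2=\cdots=x_b=1$ yields $\mathfrak{B}_t(\mathcal{G}_n)$, the $t$-th binomial transform of the Gould's sequence terms $\mathcal{G}_k$, with $k$ ranging from $0$ to $n$.
   Context: For a positive integer $N$, let $\mathcal{K}'_N=\mathbb{Z}[x_1,\ldots,x_N]/I$ with $I=\langle x_1^2-P_1,\ldots,x_N^2-P_N\rangle$, where $P_i=-2x_i+x_{i+1}$ for $1\le i<N$ and $P_N=0$. Thus $x_i^2=-2x_i+x_{i+1}$ for $1\le i<N$ and $x_N^2=0$ in $\mathcal{K}'_N$. The expansion of an element of $\mathcal{K}'_N$ is its fully reduced representative: the unique polynomial in $\mathbb{Z}[x_1,\ldots,x_N]$ of degree at most $1$ in each variable $x_i$ that represents it modulo $I$. Evaluating the expansion at $x_1=\cdots=x_N=1$ means summing the coefficients of this representative. Gould's sequence $\mathcal{G}$ has terms $\mathcal{G}_k=2^{\#(k)}$ for $k\ge 0$, where $\#(k)$ is the number of $1$s in the binary expansion of $k$ (so $\mathcal{G}_0=1$). Binomial transform: for an integer sequence $a=\{a_0,a_1,a_2,\ldots\}$ and $t\in\mathbb{Z}$, the $t$-th binomial transform is $$\mathfrak{B}_t(a_n)=\begin{cases}a_n & t=0\\ \sum_{k=0}^n\binom{n}{k}a_k & t=1\\ \sum_{k=0}^n\binom{n}{k}\mathfrak{B}_{t-1}(a_k) & t>1\\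 \sum_{k=0}^n\binom{n}{k}(-1)^{n-k}a_k & t=-1\\ \sum_{k=0}^n\binom{n}{k}(-1)^{n-k}\mathfrak{B}_{t+1}(a_k) & t<-1.\end{cases}$$ Here it is applied to $a_k=\mathcal{G}_k$. *)

theory Defs
  imports Complex_Main "HOL-Library.Poly_Mapping" "HOL-Algebra.QuotRing"
begin

text \<open>
  Polynomials over the integers in variables indexed by natural numbers are finitely supported
  functions from monomials (finitely supported exponent functions) to coefficients.
\<close>

type_synonym int_mpoly = "(nat \<Rightarrow>\<^sub>0 nat) \<Rightarrow>\<^sub>0 int"

definition X :: "nat \<Rightarrow> int_mpoly" where
  "X i = Poly_Mapping.single (Poly_Mapping.single i 1) 1"

definition eval_mpoly :: "(nat \<Rightarrow> int) \<Rightarrow> int_mpoly \<Rightarrow> int" where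
  "eval_mpoly v p =
    (\<Sum>m\<in>Poly_Mapping.keys p. Poly_Mapping.lookup p m *
      (\<Prod>i\<in>Poly_Mapping.keys m. v i ^ Poly_Mapping.lookup m i))"

text \<open>The ring \<open>\<int>[x\<^sub>1, \<dots>, x\<^sub>N]\<close>: only the variables \<^term>\<open>X 1\<close> up to \<^term>\<open>X N\<close> may occur.\<close>

definition poly_ring :: "nat \<Rightarrow> int_mpoly ring" where
  "poly_ring N =
    \<lparr>carrier = {p. \<forall>m\<in>Poly_Mapping.keys p. Poly_Mapping.keys m \<subseteq> {1..N}},
     mult = (*), one = 1, zero = 0, add = (+)\<rparr>"

definition P :: "nat \<Rightarrow> nat \<Rightarrow> int_mpoly" where
  "P N i = (if i < N then - 2 * X i + X (i + 1) else 0)"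

definition K_ideal :: "nat \<Rightarrow> int_mpoly set" where
  "K_ideal N = Idl\<^bsub>poly_ring N\<^esub> ((\<lambda>i. (X i)^2 - P N i) ` {1..N})"

definition K :: "nat \<Rightarrow> int_mpoly set ring" where
  "K N = poly_ring N Quot K_ideal N"

definition K_class :: "nat \<Rightarrow> int_mpoly \<Rightarrow> int_mpoly set" where
  "K_class N p = K_ideal N +>\<^bsub>poly_ring N\<^esub> p"

definition fully_reduced :: "int_mpoly \<Rightarrow> bool" where
  "fully_reduced p \<longleftrightarrow> (\<forall>m\<in>Poly_Mapping.keys p. \<forall>i. Poly_Mapping.lookup m i \<le> 1)"

text \<open>Elements of \<^term>\<open>K N\<close> are cosets, so a representative of \<open>c\<close> is simply a member of \<open>c\<close>.\<close>

definition expansion :: "int_mpoly set \<Rightarrow> int_mpoly" where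
  "expansion c = (THE p. p \<in> c \<and> fully_reduced p)"

definition gould :: "nat \<Rightarrow> int" where
  "gould k = 2 ^ card {i. bit k i}"

function binomial_transform :: "int \<Rightarrow> (nat \<Rightarrow> int) \<Rightarrow> nat \<Rightarrow> int" where
  "binomial_transform t a n =
    (if t = 0 then a n
     else if t = 1 then \<Sum>k=0..n. int (n choose k) * a k
     else if t > 1 then \<Sum>k=0..n. int (n choose k) * binomial_transform (t - 1) a k
     else if t = -1 then \<Sum>k=0..n. int (n choose k) * (-1) ^ (n - k) * a k
     else \<Sum>k=0..n. int (n choose k) * (-1) ^ (n - k) * binomial_transform (t + 1) a k)"
  by pat_completeness auto
termination
  by (relation "measure (\<lambda>(t, a, n). nat \<bar>t\<bar>)") auto

declare binomial_transform.simps [simp del]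

end

theory Submission
  imports Defs "HOL-Library.Nat_Bijection" "HOL-Computational_Algebra.Polynomial"
begin

text \<open>
  Put \<open>y = 1 + x\<^sub>1\<close>. The relation \<open>x\<^sub>i\<^sup>2 = -2x\<^sub>i + x\<^sub>i\<^sub>+\<^sub>1\<close> says \<open>(1 + x\<^sub>i)\<^sup>2 = 1 + x\<^sub>i\<^sub>+\<^sub>1\<close>, so
  repeated squaring of \<open>y\<close> runs through the elements \<open>1 + x\<^sub>i\<close>. Writing \<open>k\<close> in binary, \<open>y\<close> to the
  power \<open>k\<close> is therefore congruent to the product of the factors \<open>1 + x\<^sub>i\<^sub>+\<^sub>1\<close> over the positions
  \<open>i\<close> of the ones of \<open>k\<close>, provided \<open>k < 2\<^sup>N\<close> so that enough variables are present
  (\<open>one_plus_X_power_cong_gould_poly\<close>). That product is already fully reduced, and at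
  \<open>x\<^sub>1 = \<dots> = x\<^sub>N = 1\<close> every factor contributes 2, which gives the Gould number of \<open>k\<close>. Expanding
  \<open>(t + y)\<^sup>n\<close> by the binomial theorem gives a fully reduced representative with value
  \<open>\<Sum>k. (n choose k) t\<^bsup>n-k\<^esup> 2\<^bsup>#(k)\<^esup>\<close>, and this is the closed form of the \<open>t\<close>-th binomial transform
  (\<open>binomial_transform_closed_form\<close>).

  The value above is the value of the expansion only because fully reduced representatives are
  unique. For this, the variables \<open>x\<^sub>2, \<dots>, x\<^sub>N\<close> are eliminated: sending \<open>x\<^sub>i\<close> to
  \<open>Y\<^bsup>2^(i-1)\<^esup> - 1\<close> kills every relation but the last, which becomes a monic polynomial of degree
  \<open>2\<^sup>N\<close>. Squarefree monomials go to monic polynomials whose degrees are pairwise distinct, again by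
  uniqueness of binary expansions, and smaller than \<open>2\<^sup>N\<close>. Hence a nonzero fully reduced polynomial
  is never in the ideal (\<open>reduced_in_K_ideal_eq_0\<close>).
\<close>

section \<open>Substitution homomorphisms\<close>

definition mono_val :: "(nat \<Rightarrow> 'a::comm_ring_1) \<Rightarrow> (nat \<Rightarrow>\<^sub>0 nat) \<Rightarrow> 'a" where
  "mono_val v m = (\<Prod>i\<in>Poly_Mapping.keys m. v i ^ Poly_Mapping.lookup m i)"

text \<open>
  Values are taken in an arbitrary commutative ring because two targets occur: the integers, for
  the evaluation at 1, and univariate polynomials, for the uniqueness of reduced representatives.
\<close>

definition subst :: "(nat \<Rightarrow> 'a::comm_ring_1) \<Rightarrow> int_mpoly \<Rightarrow> 'a" where
  "subst v p = (\<Sum>m\<in>Poly_Mapping.keys p. of_int (Poly_Mapping.lookup p m) * mono_val v m)"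

lemma eval_mpoly_eq_subst: "eval_mpoly v = subst v"
  by (simp add: fun_eq_iff eval_mpoly_def subst_def mono_val_def)

lemma mono_val_superset:
  assumes "finite A" "Poly_Mapping.keys m \<subseteq> A"
  shows "mono_val v m = (\<Prod>i\<in>A. v i ^ Poly_Mapping.lookup m i)"
  unfolding mono_val_def using assms
  by (intro prod.mono_neutral_left) (auto simp: in_keys_iff)

lemma mono_val_add: "mono_val v (m + m') = mono_val v m * mono_val v m'"
proof -
  let ?A = "Poly_Mapping.keys m \<union> Poly_Mapping.keys m'"
  have "mono_val v (m + m') = (\<Prod>i\<in>?A. v i ^ Poly_Mapping.lookup (m + m') i)"
    by (intro mono_val_superset) (auto simp: keys_add)
  also have "\<dots> = (\<Prod>i\<in>?A. v i ^ Poly_Mapping.lookup m i) * (\<Prod>i\<in>?A. v i ^ Poly_Mapping.lookup m' i)"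
    by (simp add: lookup_add power_add prod.distrib)
  also have "\<dots> = mono_val v m * mono_val v m'"
    by (simp add: mono_val_superset[of ?A])
  finally show ?thesis .
qed

lemma subst_add: "subst v (p + q) = subst v p + subst v q"
  unfolding subst_def by (rule setsum_keys_plus_distrib) (simp_all add: algebra_simps)

lemma subst_0 [simp]: "subst v 0 = 0"
  by (simp add: subst_def)

lemma subst_diff: "subst v (p - q) = subst v p - subst v q"
  using subst_add[of v "p - q" q] by simp

lemma subst_single: "subst v (Poly_Mapping.single m c) = of_int c * mono_val v m"
  by (simp add: subst_def)

text \<open>
  Both sides are additive in each factor, and the coefficients are integers, so it suffices to
  compare them on monomials with coefficient 1.
\<close>

lemma subst_mult: "subst v (p * q) = subst v p * subst v q"
  using subset_UNIV
proof (induction p rule: frag_induction)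
  case (one m)
  show ?case
    using subset_UNIV[of "Poly_Mapping.keys q"]
    by (induction q rule: frag_induction)
      (simp_all add: mult_single subst_single mono_val_add right_diff_distrib subst_diff)
qed (simp_all add: left_diff_distrib subst_diff)

lemma subst_of_int [simp]: "subst v (of_int c) = of_int c"
  unfolding single_of_int[symmetric] by (simp add: subst_single mono_val_def)

lemma subst_1 [simp]: "subst v 1 = 1"
  using subst_of_int[of v 1] by simp

lemma subst_X [simp]: "subst v (X i) = v i"
  by (simp add: X_def subst_single mono_val_def)

lemma subst_power: "subst v (p ^ n) = subst v p ^ n"
  by (induction n) (simp_all add: subst_mult)

lemma subst_sum: "subst v (sum f A) = (\<Sum>x\<in>A. subst v (f x))"
  by (induction A rule: infinite_finite_induct) (simp_all add: subst_add)

lemma subst_prod: "subst v (prod f A) = (\<Prod>x\<in>A. subst v (f x))"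
  by (induction A rule: infinite_finite_induct) (simp_all add: subst_mult)

section \<open>The ideal and congruences modulo it\<close>

lemma carrier_poly_ring:
  "p \<in> carrier (poly_ring N) \<longleftrightarrow> (\<forall>m\<in>Poly_Mapping.keys p. Poly_Mapping.keys m \<subseteq> {1..N})"
  by (simp add: poly_ring_def)

lemma poly_ring_ops [simp]:
  "p \<oplus>\<^bsub>poly_ring N\<^esub> q = p + q" "p \<otimes>\<^bsub>poly_ring N\<^esub> q = p * q"
  "\<zero>\<^bsub>poly_ring N\<^esub> = 0" "\<one>\<^bsub>poly_ring N\<^esub> = 1"
  by (simp_all add: poly_ring_def)

lemma carrier_add:
  "p \<in> carrier (poly_ring N) \<Longrightarrow> q \<in> carrier (poly_ring N) \<Longrightarrow> p + q \<in> carrier (poly_ring N)"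
  using keys_add[of p q] by (auto simp: carrier_poly_ring)

lemma carrier_mult:
  assumes "p \<in> carrier (poly_ring N)" "q \<in> carrier (poly_ring N)"
  shows "p * q \<in> carrier (poly_ring N)"
  unfolding carrier_poly_ring
proof
  fix m assume "m \<in> Poly_Mapping.keys (p * q)"
  then obtain a b where "m = a + b" "a \<in> Poly_Mapping.keys p" "b \<in> Poly_Mapping.keys q"
    using keys_mult[of p q] by blast
  then show "Poly_Mapping.keys m \<subseteq> {1..N}"
    using assms keys_add[of a b] unfolding carrier_poly_ring by blast
qed

lemma carrier_of_int: "of_int c \<in> carrier (poly_ring N)"
  unfolding single_of_int[symmetric] by (simp add: carrier_poly_ring)

lemma carrier_0: "0 \<in> carrier (poly_ring N)" and carrier_1: "1 \<in> carrier (poly_ring N)"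
  by (simp_all add: carrier_poly_ring)

lemma carrier_uminus: "p \<in> carrier (poly_ring N) \<Longrightarrow> - p \<in> carrier (poly_ring N)"
  by (simp add: carrier_poly_ring)

lemma carrier_diff:
  "p \<in> carrier (poly_ring N) \<Longrightarrow> q \<in> carrier (poly_ring N) \<Longrightarrow> p - q \<in> carrier (poly_ring N)"
  using carrier_add[of p N "- q"] carrier_uminus[of q N] by simp

lemma carrier_X: "1 \<le> i \<Longrightarrow> i \<le> N \<Longrightarrow> X i \<in> carrier (poly_ring N)"
  by (simp add: carrier_poly_ring X_def)

lemma carrier_power: "p \<in> carrier (poly_ring N) \<Longrightarrow> p ^ n \<in> carrier (poly_ring N)"
  by (induction n) (auto intro: carrier_mult carrier_1)

lemma carrier_prod:
  "(\<And>x. x \<in> A \<Longrightarrow> f x \<in> carrier (poly_ring N)) \<Longrightarrow> prod f A \<in> carrier (poly_ring N)"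
  by (induction A rule: infinite_finite_induct) (auto intro: carrier_mult carrier_1)

lemma poly_ring_cring: "cring (poly_ring N)"
proof (rule cringI)
  show "abelian_group (poly_ring N)"
  proof (rule abelian_groupI)
    fix p assume "p \<in> carrier (poly_ring N)"
    then show "\<exists>q\<in>carrier (poly_ring N). q \<oplus>\<^bsub>poly_ring N\<^esub> p = \<zero>\<^bsub>poly_ring N\<^esub>"
      by (intro bexI[of _ "- p"]) (auto intro: carrier_uminus)
  qed (auto intro: carrier_add simp: carrier_0 algebra_simps)
  show "comm_monoid (poly_ring N)"
    by (rule comm_monoidI) (auto intro: carrier_mult simp: carrier_1 algebra_simps)
qed (auto simp: algebra_simps)

text \<open>
  Closure under negation comes for free from multiplication by the constant \<open>-1\<close>.
\<close>

lemma ideal_poly_ringI: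
  assumes sub: "I \<subseteq> carrier (poly_ring N)" and "0 \<in> I"
    and add: "\<And>p q. p \<in> I \<Longrightarrow> q \<in> I \<Longrightarrow> p + q \<in> I"
    and mult: "\<And>p q. p \<in> carrier (poly_ring N) \<Longrightarrow> q \<in> I \<Longrightarrow> p * q \<in> I"
  shows "ideal I (poly_ring N)"
proof -
  interpret cring "poly_ring N" by (rule poly_ring_cring)
  show ?thesis
  proof (rule idealI)
    show "subgroup I (add_monoid (poly_ring N))"
    proof (rule add.subgroupI)
      fix a assume a: "a \<in> I"
      have "- a \<in> I"
        using mult[OF carrier_uminus[OF carrier_1] a] by simp
      moreover have "\<ominus>\<^bsub>poly_ring N\<^esub> a = - a"
        using a sub \<open>- a \<in> I\<close> by (intro minus_equality) auto
      ultimately show "\<ominus>\<^bsub>poly_ring N\<^esub> a \<in> I" by simp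
    qed (use assms in auto)
  next
    fix a x assume "a \<in> I" "x \<in> carrier (poly_ring N)"
    then have "x * a \<in> I" by (intro mult)
    then show "x \<otimes>\<^bsub>poly_ring N\<^esub> a \<in> I" "a \<otimes>\<^bsub>poly_ring N\<^esub> x \<in> I"
      by (simp_all add: Groups.mult.commute[of a x])
  qed (rule ring_axioms)
qed

lemma generators_in_carrier:
  "(\<lambda>i. (X i)^2 - P N i) ` {1..N} \<subseteq> carrier (poly_ring N)"
proof -
  have "P N i \<in> carrier (poly_ring N)" if "i \<in> {1..N}" for i
  proof (cases "i < N")
    case True
    have "of_int (- 2) * X i + X (i + 1) \<in> carrier (poly_ring N)"
      using that True by (intro carrier_add carrier_mult carrier_of_int carrier_X) auto
    then show ?thesis using True by (simp add: P_def)
  qed (simp add: P_def carrier_0)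
  then show ?thesis
    by (auto intro!: carrier_diff carrier_power carrier_X)
qed

lemma K_ideal_ideal: "ideal (K_ideal N) (poly_ring N)"
  unfolding K_ideal_def
  by (intro ring.genideal_ideal cring.axioms(1) poly_ring_cring generators_in_carrier)

lemma K_ideal_gen: "i \<in> {1..N} \<Longrightarrow> (X i)^2 - P N i \<in> K_ideal N"
  using ring.genideal_self[OF cring.axioms(1)[OF poly_ring_cring] generators_in_carrier]
  unfolding K_ideal_def by blast

lemma K_ideal_0: "0 \<in> K_ideal N"
  using additive_subgroup.zero_closed[OF ideal.axioms(1)[OF K_ideal_ideal[of N]]] by simp

lemma K_ideal_add: "p \<in> K_ideal N \<Longrightarrow> q \<in> K_ideal N \<Longrightarrow> p + q \<in> K_ideal N"
  using additive_subgroup.a_closed[OF ideal.axioms(1)[OF K_ideal_ideal[of N]]] by simp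

lemma K_ideal_mult: "p \<in> carrier (poly_ring N) \<Longrightarrow> q \<in> K_ideal N \<Longrightarrow> p * q \<in> K_ideal N"
  using ideal.I_l_closed[OF K_ideal_ideal[of N]] by simp

lemma K_ideal_uminus: "p \<in> K_ideal N \<Longrightarrow> - p \<in> K_ideal N"
  using K_ideal_mult[OF carrier_uminus[OF carrier_1]] by fastforce

lemma K_ideal_sum: "(\<And>x. x \<in> A \<Longrightarrow> f x \<in> K_ideal N) \<Longrightarrow> sum f A \<in> K_ideal N"
  by (induction A rule: infinite_finite_induct) (auto intro: K_ideal_add K_ideal_0)

lemma mem_K_class: "p \<in> K_class N q \<longleftrightarrow> p - q \<in> K_ideal N"
  by (force simp: K_class_def a_r_coset_def')

lemma K_class_power:
  assumes "p \<in> carrier (poly_ring N)"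
  shows "K_class N p [^]\<^bsub>K N\<^esub> (n::nat) = K_class N (p ^ n)"
proof (induction n)
  case 0
  show ?case by (simp add: nat_pow_def K_def K_class_def FactRing_def)
next
  case (Suc n)
  have "K_class N p [^]\<^bsub>K N\<^esub> Suc n = K_class N p [^]\<^bsub>K N\<^esub> n \<otimes>\<^bsub>K N\<^esub> K_class N p"
    by (simp add: nat_pow_def)
  also have "\<dots> = K_class N (p ^ n * p)"
    using ideal.rcoset_mult_add[OF K_ideal_ideal carrier_power[OF assms] assms]
    by (simp add: Suc.IH) (simp add: K_def K_class_def FactRing_def)
  finally show ?case by (simp add: mult.commute)
qed

lemma K_ideal_mult_cong:
  assumes "a - a' \<in> K_ideal N" "c - c' \<in> K_ideal N"
    and "a' \<in> carrier (poly_ring N)" "c \<in> carrier (poly_ring N)"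
  shows "a * c - a' * c' \<in> K_ideal N"
proof -
  have "a * c - a' * c' = c * (a - a') + a' * (c - c')" by (simp add: algebra_simps)
  then show ?thesis using assms by (auto intro: K_ideal_add K_ideal_mult)
qed

lemma K_ideal_prod_cong:
  assumes "\<And>x. x \<in> A \<Longrightarrow> f x - g x \<in> K_ideal N"
    and "\<And>x. x \<in> A \<Longrightarrow> f x \<in> carrier (poly_ring N)"
    and "\<And>x. x \<in> A \<Longrightarrow> g x \<in> carrier (poly_ring N)"
  shows "prod f A - prod g A \<in> K_ideal N"
  using assms
  by (induction A rule: infinite_finite_induct)
    (auto simp: K_ideal_0 intro!: K_ideal_mult_cong carrier_prod)

section \<open>Uniqueness of the fully reduced representative\<close>

text \<open>
  The image of \<open>x\<^sub>i\<close> in \<open>\<int>[Y]\<close>, where \<open>Y\<close> plays the role of \<open>1 + x\<^sub>1\<close>: solving the relations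
  \<open>(1 + x\<^sub>i)\<^sup>2 = 1 + x\<^sub>i\<^sub>+\<^sub>1\<close> successively expresses every variable through \<open>x\<^sub>1\<close>.
\<close>

definition collapse :: "nat \<Rightarrow> int poly" where
  "collapse i = monom 1 (2 ^ (i - 1)) - 1"

lemma collapse_degree: "degree (collapse i) = 2 ^ (i - 1)"
  and collapse_lead_coeff: "lead_coeff (collapse i) = 1"
proof -
  show deg: "degree (collapse i) = 2 ^ (i - 1)"
    unfolding collapse_def diff_conv_add_uminus
    by (subst degree_add_eq_left) (auto simp: degree_monom_eq)
  show "lead_coeff (collapse i) = 1"
    unfolding deg by (simp add: collapse_def)
qed

text \<open>
  The generators with \<open>i < N\<close> vanish under the substitution, and the last one, \<open>x\<^sub>N\<^sup>2\<close>, becomes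
  \<open>(collapse N)\<^sup>2\<close>. The polynomials whose image is divisible by that square form an ideal, so they
  include everything generated.
\<close>

lemma subst_collapse_K_ideal:
  assumes "p \<in> K_ideal N" "N \<ge> 1"
  shows "(collapse N)\<^sup>2 dvd subst collapse p"
proof -
  let ?J = "{p \<in> carrier (poly_ring N). (collapse N)\<^sup>2 dvd subst collapse p}"
  have "ideal ?J (poly_ring N)"
    by (rule ideal_poly_ringI)
      (auto simp: carrier_0 subst_add subst_mult intro: carrier_add carrier_mult)
  moreover have "(\<lambda>i. (X i)\<^sup>2 - P N i) ` {1..N} \<subseteq> ?J"
  proof -
    have "(collapse N)\<^sup>2 dvd subst collapse ((X i)\<^sup>2 - P N i)" if i: "i \<in> {1..N}" for i
    proof (cases "i < N")
      case True
      have "(monom 1 (2 ^ (i - 1)) :: int poly)\<^sup>2 = monom 1 (2 ^ i)"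
        using i by (simp add: power2_eq_square mult_monom flip: mult_2 power_Suc)
      then have "(collapse i)\<^sup>2 + 2 * collapse i - collapse (Suc i) = 0"
        by (simp add: collapse_def power2_eq_square algebra_simps)
      moreover have "subst collapse (2 * X i) = 2 * collapse i"
        using subst_of_int[of collapse 2] by (simp add: subst_mult)
      ultimately have "subst collapse ((X i)\<^sup>2 - P N i) = 0"
        using True by (simp add: P_def subst_diff subst_power subst_add algebra_simps)
      then show ?thesis by simp
    next
      case False
      with i show ?thesis by (simp add: P_def subst_power)
    qed
    then show ?thesis using generators_in_carrier[of N] by blast
  qed
  ultimately have "K_ideal N \<subseteq> ?J"
    unfolding K_ideal_def
    by (intro ring.genideal_minimal cring.axioms(1) poly_ring_cring)
  then show ?thesis using assms by blast
qed

lemma reduced_mono_val: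
  assumes "\<forall>i. Poly_Mapping.lookup m i \<le> 1"
  shows "mono_val v m = (\<Prod>i\<in>Poly_Mapping.keys m. v i)"
  unfolding mono_val_def
proof (rule prod.cong)
  fix i assume "i \<in> Poly_Mapping.keys m"
  then have "Poly_Mapping.lookup m i = 1"
    using assms by (metis in_keys_iff le_neq_implies_less less_one)
  then show "v i ^ Poly_Mapping.lookup m i = v i" by simp
qed simp

lemma reduced_mono_eqI:
  fixes m m' :: "nat \<Rightarrow>\<^sub>0 nat"
  assumes "\<forall>i. Poly_Mapping.lookup m i \<le> 1" "\<forall>i. Poly_Mapping.lookup m' i \<le> 1"
    and "Poly_Mapping.keys m = Poly_Mapping.keys m'"
  shows "m = m'"
proof (rule poly_mapping_eqI)
  fix i
  show "Poly_Mapping.lookup m i = Poly_Mapping.lookup m' i"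
    using assms by (metis in_keys_iff le_neq_implies_less less_one)
qed

text \<open>
  The factor \<open>x\<^sub>i\<close> contributes degree \<open>2\<^bsup>i-1\<^esup>\<close>, so the degree of the image is the number whose
  binary digits mark the variables that occur. The degree thus determines the monomial.
\<close>

lemma reduced_mono_degree:
  assumes "\<forall>i. Poly_Mapping.lookup m i \<le> 1" "Poly_Mapping.keys m \<subseteq> {1..N}"
  shows "degree (mono_val collapse m) = set_encode ((\<lambda>i. i - 1) ` Poly_Mapping.keys m)"
    and "lead_coeff (mono_val collapse m) = 1"
proof -
  have inj: "inj_on (\<lambda>i. i - 1) (Poly_Mapping.keys m)"
    using assms(2) by (auto simp: inj_on_def subset_iff Suc_le_eq) (metis One_nat_def Suc_pred)
  have nz: "collapse i \<noteq> 0" for i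
    using collapse_lead_coeff[of i] by auto
  have "degree (mono_val collapse m) = (\<Sum>i\<in>Poly_Mapping.keys m. 2 ^ (i - 1))"
    using nz by (simp add: reduced_mono_val[OF assms(1)] degree_prod_eq_sum_degree collapse_degree)
  also have "\<dots> = set_encode ((\<lambda>i. i - 1) ` Poly_Mapping.keys m)"
    unfolding set_encode_def sum.reindex[OF inj] by simp
  finally show "degree (mono_val collapse m) = set_encode ((\<lambda>i. i - 1) ` Poly_Mapping.keys m)" .
  show "lead_coeff (mono_val collapse m) = 1"
    unfolding reduced_mono_val[OF assms(1)] lead_coeff_prod
    by (simp add: collapse_lead_coeff)
qed

text \<open>
  Only one summand reaches the largest degree, so its leading term cannot cancel.
\<close>

lemma sum_smult_distinct_degree_neq_0:
  fixes f :: "'b \<Rightarrow> 'a::idom poly"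
  assumes "finite A" "A \<noteq> {}" "inj_on (\<lambda>x. degree (f x)) A"
    and "\<And>x. x \<in> A \<Longrightarrow> c x \<noteq> 0" "\<And>x. x \<in> A \<Longrightarrow> f x \<noteq> 0"
  shows "(\<Sum>x\<in>A. smult (c x) (f x)) \<noteq> 0"
proof -
  have "Max ((\<lambda>x. degree (f x)) ` A) \<in> (\<lambda>x. degree (f x)) ` A"
    using assms(1,2) by simp
  then obtain z where z: "z \<in> A" "degree (f z) = Max ((\<lambda>x. degree (f x)) ` A)"
    by auto
  have "coeff (f x) (degree (f z)) = 0" if "x \<in> A" "x \<noteq> z" for x
  proof -
    have "degree (f x) \<le> degree (f z)" using that z assms(1) by simp
    moreover have "degree (f x) \<noteq> degree (f z)"
      using inj_onD[OF assms(3), of x z] that z(1) by auto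
    ultimately show ?thesis by (simp add: coeff_eq_0)
  qed
  then have "coeff (\<Sum>x\<in>A. smult (c x) (f x)) (degree (f z))
      = (\<Sum>x\<in>A. if x = z then c z * lead_coeff (f z) else 0)"
    unfolding coeff_sum by (intro sum.cong) auto
  also have "\<dots> = c z * lead_coeff (f z)" using z assms(1) by simp
  also have "\<dots> \<noteq> 0" using assms(4,5)[OF z(1)] by simp
  finally show ?thesis by auto
qed

lemma set_encode_less_power:
  assumes "A \<subseteq> {..<N}"
  shows "set_encode A < 2 ^ N"
proof -
  have "set_encode A \<le> (\<Sum>i<N. 2 ^ i)"
    unfolding set_encode_def using assms by (intro sum_mono2) auto
  also have "\<dots> < 2 ^ N"
    by (induction N) auto
  finally show ?thesis .
qed

text \<open>
  The image of a nonzero reduced polynomial is nonzero of degree less than \<open>2\<^sup>N\<close>, too small for a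
  multiple of \<open>(collapse N)\<^sup>2\<close>, which has degree \<open>2\<^sup>N\<close>.
\<close>

lemma reduced_in_K_ideal_eq_0:
  assumes p: "p \<in> K_ideal N" and red: "fully_reduced p" and "N \<ge> 1"
  shows "p = 0"
proof (rule ccontr)
  assume "p \<noteq> 0"
  have "p \<in> carrier (poly_ring N)"
    using ideal.Icarr[OF K_ideal_ideal p] .
  then have m: "\<forall>i. Poly_Mapping.lookup m i \<le> 1" "Poly_Mapping.keys m \<subseteq> {1..N}"
    if "m \<in> Poly_Mapping.keys p" for m
    using that red by (auto simp: carrier_poly_ring fully_reduced_def)
  have eq: "subst collapse p
      = (\<Sum>m\<in>Poly_Mapping.keys p. smult (Poly_Mapping.lookup p m) (mono_val collapse m))"
    by (simp add: subst_def of_int_poly)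
  have "inj_on (\<lambda>m. degree (mono_val collapse m)) (Poly_Mapping.keys p)"
  proof (rule inj_onI)
    fix k l assume kl: "k \<in> Poly_Mapping.keys p" "l \<in> Poly_Mapping.keys p"
      and "degree (mono_val collapse k) = degree (mono_val collapse l)"
    then have "set_encode ((\<lambda>i. i - 1) ` Poly_Mapping.keys k)
        = set_encode ((\<lambda>i. i - 1) ` Poly_Mapping.keys l)"
      using reduced_mono_degree(1)[OF m[OF kl(1)]] reduced_mono_degree(1)[OF m[OF kl(2)]] by simp
    then have "(\<lambda>i. i - 1) ` Poly_Mapping.keys k = (\<lambda>i. i - 1) ` Poly_Mapping.keys l"
      by (simp add: set_encode_eq)
    moreover have "inj_on (\<lambda>i::nat. i - 1) {1..N}"
      by (auto simp: inj_on_def)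
    ultimately have "Poly_Mapping.keys k = Poly_Mapping.keys l"
      using m(2)[OF kl(1)] m(2)[OF kl(2)] by (simp add: inj_on_image_eq_iff)
    then show "k = l" using m kl by (intro reduced_mono_eqI)
  qed
  moreover have "mono_val collapse k \<noteq> 0" if "k \<in> Poly_Mapping.keys p" for k
    using reduced_mono_degree(2)[OF m[OF that]] by auto
  ultimately have nz: "subst collapse p \<noteq> 0"
    unfolding eq using \<open>p \<noteq> 0\<close>
    by (intro sum_smult_distinct_degree_neq_0) (auto simp: in_keys_iff)
  have "degree (subst collapse p) \<le> 2 ^ N - 1"
    unfolding eq
  proof (rule degree_sum_le)
    fix k assume k: "k \<in> Poly_Mapping.keys p"
    have "(\<lambda>i. i - 1) ` Poly_Mapping.keys k \<subseteq> {..<N}" using m(2)[OF k] by force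
    then have "degree (mono_val collapse k) < 2 ^ N"
      using m[OF k] by (simp add: reduced_mono_degree set_encode_less_power)
    then show "degree (smult (Poly_Mapping.lookup p k) (mono_val collapse k)) \<le> 2 ^ N - 1"
      using degree_smult_le[of "Poly_Mapping.lookup p k" "mono_val collapse k"] by linarith
  qed simp
  moreover have "degree ((collapse N)\<^sup>2) = 2 ^ N"
  proof -
    have "collapse N \<noteq> 0" using collapse_lead_coeff[of N] by auto
    then have "degree ((collapse N)\<^sup>2) = 2 * 2 ^ (N - 1)"
      by (simp add: degree_power_eq collapse_degree)
    then show ?thesis using \<open>N \<ge> 1\<close> by (simp flip: power_Suc)
  qed
  moreover have "degree ((collapse N)\<^sup>2) \<le> degree (subst collapse p)"
    using subst_collapse_K_ideal[OF p \<open>N \<ge> 1\<close>] nz by (rule dvd_imp_degree_le)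
  moreover have "(2::nat) ^ N > 0" by simp
  ultimately show False by linarith
qed

lemma fully_reduced_add: "fully_reduced p \<Longrightarrow> fully_reduced q \<Longrightarrow> fully_reduced (p + q)"
  using keys_add[of p q] by (auto simp: fully_reduced_def)

lemma fully_reduced_uminus: "fully_reduced p \<Longrightarrow> fully_reduced (- p)"
  by (simp add: fully_reduced_def)

lemma fully_reduced_0: "fully_reduced 0"
  by (simp add: fully_reduced_def)

lemma fully_reduced_sum: "(\<And>x. x \<in> A \<Longrightarrow> fully_reduced (f x)) \<Longrightarrow> fully_reduced (sum f A)"
  by (induction A rule: infinite_finite_induct) (auto intro: fully_reduced_add fully_reduced_0)

lemma fully_reduced_smult:
  assumes "fully_reduced p"
  shows "fully_reduced (of_int c * p)"
proof -
  have "Poly_Mapping.keys (of_int c :: int_mpoly) \<subseteq> {0}"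
    unfolding single_of_int[symmetric] by simp
  then have "Poly_Mapping.keys (of_int c * p) \<subseteq> Poly_Mapping.keys p"
    using keys_mult[of "of_int c" p] by fastforce
  then show ?thesis using assms by (auto simp: fully_reduced_def)
qed

lemma expansion_eqI:
  assumes "p - q \<in> K_ideal N" "fully_reduced p" "N \<ge> 1"
  shows "expansion (K_class N q) = p"
  unfolding expansion_def
proof (rule the_equality)
  show "p \<in> K_class N q \<and> fully_reduced p" using assms by (simp add: mem_K_class)
next
  fix r assume r: "r \<in> K_class N q \<and> fully_reduced r"
  have "(r - q) + - (p - q) \<in> K_ideal N"
    using r assms by (intro K_ideal_add K_ideal_uminus) (simp_all add: mem_K_class)
  then have "r - p \<in> K_ideal N" by simp
  moreover have "fully_reduced (r - p)"
    using r assms fully_reduced_add[of r "- p"] fully_reduced_uminus[of p] by simp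
  ultimately show "r = p" using reduced_in_K_ideal_eq_0 assms(3) by fastforce
qed

section \<open>Powers of the first generator\<close>

text \<open>
  For \<open>k < 2\<^sup>N\<close>, the reduced representative of \<open>(1 + x\<^sub>1)\<^bsup>k\<^esup>\<close>. Binary digits are counted from 0
  and variables from 1, whence the \<open>Suc\<close>.
\<close>

definition gould_poly :: "nat \<Rightarrow> int_mpoly" where
  "gould_poly k = (\<Prod>i\<in>set_decode k. 1 + X (Suc i))"

lemma set_decode_eq_bits: "set_decode k = {i. bit k i}"
  by (simp add: set_decode_def bit_iff_odd)

lemma gould_poly_eval: "subst (\<lambda>_. 1) (gould_poly k) = gould k"
  by (simp add: gould_poly_def gould_def subst_prod subst_add set_decode_eq_bits)

text \<open>
  Besides the bound 1 needed for reducedness, the induction has to know that a variable outside the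
  product does not occur, so that multiplying by a new factor raises its exponent from 0 to 1.
\<close>

lemma lookup_prod_one_plus_X_le:
  assumes "finite A" "m \<in> Poly_Mapping.keys (\<Prod>i\<in>A. 1 + X (Suc i))"
  shows "Poly_Mapping.lookup m j \<le> (if j \<in> Suc ` A then 1 else 0)"
  using assms
proof (induction A arbitrary: m j rule: finite_induct)
  case empty
  then show ?case by simp
next
  case (insert a A)
  let ?q = "\<Prod>i\<in>A. 1 + X (Suc i)"
  have "m \<in> Poly_Mapping.keys (?q + X (Suc a) * ?q)"
    using insert by (simp add: distrib_right)
  then consider "m \<in> Poly_Mapping.keys ?q"
    | n where "n \<in> Poly_Mapping.keys ?q" "m = Poly_Mapping.single (Suc a) 1 + n"
    using keys_add[of ?q "X (Suc a) * ?q"] keys_mult[of "X (Suc a)" ?q]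
    by (fastforce simp: X_def)
  then show ?case
  proof cases
    case 1
    then show ?thesis using insert.IH[of m j] by (auto split: if_splits)
  next
    case 2
    then show ?thesis using insert.IH[of n j] insert.hyps
      by (auto simp: lookup_add lookup_single when_def split: if_splits)
  qed
qed

lemma fully_reduced_gould_poly: "fully_reduced (gould_poly k)"
  unfolding fully_reduced_def gould_poly_def
  using lookup_prod_one_plus_X_le[OF finite_set_decode]
  by (meson le_trans le_refl zero_le_one if_splits)

text \<open>
  Squaring \<open>1 + x\<^sub>i\<close> gives \<open>1 + x\<^sub>i\<^sub>+\<^sub>1\<close> for \<open>i < N\<close>, because the difference is
  exactly the \<open>i\<close>-th generator.
\<close>

lemma one_plus_X_power_cong:
  assumes "Suc i \<le> N"
  shows "(1 + X 1) ^ (2 ^ i) - (1 + X (Suc i)) \<in> K_ideal N"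
  using assms
proof (induction i)
  case 0
  then show ?case by (simp add: K_ideal_0)
next
  case (Suc i)
  have c: "1 + X j \<in> carrier (poly_ring N)" if "1 \<le> j" "j \<le> N" for j
    using that by (intro carrier_add carrier_1 carrier_X)
  have "(1 + X 1) ^ (2 ^ i) * (1 + X 1) ^ (2 ^ i) - (1 + X (Suc i)) * (1 + X (Suc i)) \<in> K_ideal N"
    using Suc by (intro K_ideal_mult_cong carrier_power c) auto
  moreover have "(X (Suc i))\<^sup>2 - P N (Suc i) \<in> K_ideal N"
    using Suc.prems by (intro K_ideal_gen) auto
  ultimately have "((1 + X 1) ^ (2 ^ i) * (1 + X 1) ^ (2 ^ i) - (1 + X (Suc i)) * (1 + X (Suc i)))
      + ((X (Suc i))\<^sup>2 - P N (Suc i)) \<in> K_ideal N"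
    by (rule K_ideal_add)
  moreover have "(1 + X 1) ^ (2 ^ Suc i) = (1 + X 1) ^ (2 ^ i) * ((1 + X 1) ^ (2 ^ i) :: int_mpoly)"
    by (simp add: power_add[symmetric] mult_2)
  ultimately show ?case
    using Suc.prems by (simp add: P_def algebra_simps power2_eq_square mult_2)
qed

lemma one_plus_X_power_cong_gould_poly:
  assumes "k < 2 ^ N"
  shows "(1 + X 1) ^ k - gould_poly k \<in> K_ideal N"
proof -
  have bits: "Suc i \<le> N" if "i \<in> set_decode k" for i
  proof -
    have "2 ^ i \<le> k" using that
      by (metis set_decode_def div_less even_zero mem_Collect_eq not_less)
    then have "(2::nat) ^ i < 2 ^ N" using assms by (rule le_less_trans)
    then show ?thesis by simp
  qed
  have "(1 + X 1 :: int_mpoly) ^ k = (1 + X 1) ^ (\<Sum>i\<in>set_decode k. 2 ^ i)"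
    by (metis set_decode_inverse set_encode_def)
  also have "\<dots> = (\<Prod>i\<in>set_decode k. (1 + X 1) ^ (2 ^ i))"
    by (rule power_sum)
  finally have "(1 + X 1 :: int_mpoly) ^ k = (\<Prod>i\<in>set_decode k. (1 + X 1) ^ (2 ^ i))" .
  moreover have "1 + X j \<in> carrier (poly_ring N)" if "1 \<le> j" "j \<le> N" for j
    using that by (intro carrier_add carrier_1 carrier_X)
  moreover have "N \<ge> 1" if "i \<in> set_decode k" for i
    using bits[OF that] by simp
  ultimately show ?thesis
    unfolding gould_poly_def
    by (auto intro!: K_ideal_prod_cong one_plus_X_power_cong[unfolded One_nat_def] carrier_power
        dest: bits)
qed

section \<open>The binomial transform in closed form\<close>

text \<open>
  Transforms with parameters \<open>s\<close> and \<open>t\<close> compose to the one with parameter \<open>s + t\<close>: after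
  exchanging the sums, \<open>(n choose k) (k choose j) = (n choose j) (n-j choose k-j)\<close> leaves the
  binomial expansion of \<open>(s + t)\<^bsup>n-j\<^esup>\<close>.
\<close>

lemma binomial_compose:
  fixes s t :: int
  shows "(\<Sum>k=0..n. int (n choose k) * s ^ (n - k) * (\<Sum>j=0..k. int (k choose j) * t ^ (k - j) * a j))
    = (\<Sum>j=0..n. int (n choose j) * (s + t) ^ (n - j) * a j)"
proof -
  have "(\<Sum>k=0..n. int (n choose k) * s ^ (n - k) * (\<Sum>j=0..k. int (k choose j) * t ^ (k - j) * a j))
    = (\<Sum>k=0..n. \<Sum>j=0..k. int (n choose k) * s ^ (n - k) * (int (k choose j) * t ^ (k - j) * a j))"
    by (simp add: sum_distrib_left)
  also have "\<dots> = (\<Sum>j=0..n. \<Sum>k=j..n. int (n choose k) * s ^ (n - k) * (int (k choose j) * t ^ (k - j) * a j))"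
    unfolding sum.Sigma[OF finite_atLeastAtMost ballI[OF finite_atLeastAtMost]]
    by (rule sum.reindex_bij_witness[of _ "\<lambda>(j, k). (k, j)" "\<lambda>(k, j). (j, k)"]) auto
  also have "\<dots> = (\<Sum>j=0..n. int (n choose j) * (s + t) ^ (n - j) * a j)"
  proof (rule sum.cong)
    fix j assume "j \<in> {0..n}"
    then have j: "j \<le> n" by simp
    have "(\<Sum>k=j..n. int (n choose k) * s ^ (n - k) * (int (k choose j) * t ^ (k - j) * a j))
      = (\<Sum>k=j..n. int (n choose j) * a j * (int ((n - j) choose (k - j)) * t ^ (k - j) * s ^ (n - j - (k - j))))"
    proof (rule sum.cong)
      fix k assume "k \<in> {j..n}"
      then have "int (n choose k) * int (k choose j) = int (n choose j) * int ((n - j) choose (k - j))"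
        and "n - k = n - j - (k - j)"
        using choose_mult[of j k n] by (auto simp flip: of_nat_mult)
      then show "int (n choose k) * s ^ (n - k) * (int (k choose j) * t ^ (k - j) * a j)
        = int (n choose j) * a j * (int ((n - j) choose (k - j)) * t ^ (k - j) * s ^ (n - j - (k - j)))"
        by (simp add: mult.assoc mult.left_commute mult.commute)
    qed simp
    also have "\<dots> = int (n choose j) * a j
        * (\<Sum>k=j..n. int ((n - j) choose (k - j)) * t ^ (k - j) * s ^ (n - j - (k - j)))"
      by (simp add: sum_distrib_left)
    also have "(\<Sum>k=j..n. int ((n - j) choose (k - j)) * t ^ (k - j) * s ^ (n - j - (k - j)))
        = (\<Sum>i\<le>n - j. int ((n - j) choose i) * t ^ i * s ^ (n - j - i))"
      by (rule sum.reindex_bij_witness[of _ "\<lambda>i. i + j" "\<lambda>k. k - j"]) (use j in auto)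
    also have "\<dots> = (t + s) ^ (n - j)"
      by (simp add: binomial_ring)
    finally show "(\<Sum>k=j..n. int (n choose k) * s ^ (n - k) * (int (k choose j) * t ^ (k - j) * a j))
      = int (n choose j) * (s + t) ^ (n - j) * a j"
      by (simp add: algebra_simps)
  qed simp
  finally show ?thesis .
qed

text \<open>
  Each recursion step of the transform composes with parameter \<open>1\<close> or \<open>-1\<close>. For \<open>t = 0\<close> the
  formula relies on \<open>0\<^sup>0 = 1\<close>, which leaves only the term \<open>k = n\<close>.
\<close>

lemma binomial_transform_closed_form:
  "binomial_transform t a n = (\<Sum>k=0..n. int (n choose k) * t ^ (n - k) * a k)"
proof (induction t a n rule: binomial_transform.induct)
  case (1 t a n)
  consider "t = 0" | "t = 1" | "t > 1" | "t = -1" | "t < -1" by linarith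
  then show ?case
  proof cases
    case 1
    have "(\<Sum>k=0..n. int (n choose k) * 0 ^ (n - k) * a k) = (\<Sum>k=0..n. if k = n then a n else 0)"
      by (intro sum.cong) auto
    also have "\<dots> = a n" by simp
    finally show ?thesis using 1 by (subst binomial_transform.simps) simp
  next
    case 3
    then have "binomial_transform t a n = (\<Sum>k=0..n. int (n choose k) * 1 ^ (n - k) *
        (\<Sum>j=0..k. int (k choose j) * (t - 1) ^ (k - j) * a j))"
      using "1.IH"(1) by (simp add: binomial_transform.simps[of t])
    then show ?thesis unfolding binomial_compose by simp
  next
    case 5
    then have "binomial_transform t a n = (\<Sum>k=0..n. int (n choose k) * (-1) ^ (n - k) *
        (\<Sum>j=0..k. int (k choose j) * (t + 1) ^ (k - j) * a j))"
      using "1.IH"(2) by (simp add: binomial_transform.simps[of t])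
    then show ?thesis unfolding binomial_compose by simp
  qed (simp_all add: binomial_transform.simps[of 1] binomial_transform.simps[of "- 1"])
qed

section \<open>Evaluating the expansion of a power\<close>

theorem proposition12:
  fixes n b :: nat and t :: int
  assumes "n > 0"
    and "b = nat \<lfloor>log 2 (real n)\<rfloor> + 2"
  shows "eval_mpoly (\<lambda>_. 1) (expansion ((K_class b (of_int (t + 1) + X 1)) [^]\<^bsub>K b\<^esub> n))
    = binomial_transform t gould n"
proof -
  have b: "b \<ge> 1" "n < 2 ^ b"
  proof -
    have "real n < 2 powr (of_int \<lfloor>log 2 (real n)\<rfloor> + 1)"
      using assms(1) by (simp flip: log_less_iff)
    also have "of_int \<lfloor>log 2 (real n)\<rfloor> + 1 \<le> real b"
      using assms by simp
    finally have "real n < 2 ^ b" by (simp add: powr_realpow)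
    then show "n < 2 ^ b" by (simp add: of_nat_less_numeral_power_cancel_iff)
  qed (use assms in simp)
  let ?q = "of_int (t + 1) + X 1 :: int_mpoly"
  let ?c = "\<lambda>k. int (n choose k) * t ^ (n - k)"
  let ?E = "\<Sum>k\<le>n. of_int (?c k) * gould_poly k"
  \<comment> \<open>The shift by 1 turns \<open>t + 1 + x\<^sub>1\<close> into \<open>t + y\<close>, the form in which powers of \<open>y\<close> appear.\<close>
  have "?q ^ n = ((1 + X 1) + of_int t) ^ n"
    by (simp add: algebra_simps)
  also have "\<dots> = (\<Sum>k\<le>n. of_int (?c k) * (1 + X 1) ^ k)"
    unfolding binomial_ring by (intro sum.cong) (simp_all add: algebra_simps)
  finally have "?E - ?q ^ n = (\<Sum>k\<le>n. - (of_int (?c k) * ((1 + X 1) ^ k - gould_poly k)))"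
    by (simp add: sum_subtractf right_diff_distrib)
  also have "\<dots> \<in> K_ideal b"
    using b by (intro K_ideal_sum K_ideal_uminus K_ideal_mult carrier_of_int
        one_plus_X_power_cong_gould_poly) auto
  finally have "expansion (K_class b (?q ^ n)) = ?E"
    using b by (intro expansion_eqI fully_reduced_sum fully_reduced_smult fully_reduced_gould_poly)
  moreover have "K_class b ?q [^]\<^bsub>K b\<^esub> n = K_class b (?q ^ n)"
    using b by (intro K_class_power carrier_add carrier_of_int carrier_X) auto
  ultimately show ?thesis
    by (simp add: eval_mpoly_eq_subst subst_sum subst_mult gould_poly_eval
        binomial_transform_closed_form atMost_atLeast0 del: of_int_mult)
qed

end
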